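(* If an abstract upper density $\delta$ is atomless, then the ideal $\mathcal{Z}_\delta$ of its zero sets does not satisfy the diagonal intersection property.
   Context: $\mathbb{N}$ is the set of positive integers. An abstract upper density is a function $\delta:\mathcal{P}(\mathbb{N})\to[0,1]$ with $\delta(\mathbb{N})=1$, $\delta(F)=0$ for all finite $F$, $\delta(A)\le\delta(B)$ whenever $A\subseteq B$, and $\delta(A\cup B)\le\delta(A)+\delta(B)$. It is atomless if for every $A\subseteq\mathbb{N}$ with $\delta(A)>0$ there is $B\subset A$ with $0<\delta(B)<\delta(A)$. $\mathcal{Z}_\delta:=\{A\subseteq\mathbb{N}\mid\delta(A)=0\}$. An ideal $\mathcal{I}\subseteq\mathcal{P}(\mathbb{N})$ has the diagonal intersection property if for every sequence $\langle B_n\mid n\in\mathbb{N}\rangle$ with $B_n\notin\mathcal{I}$ and $B_{n+1}\setminus B_n\in\mathcal{I}$ for all $n$, there exists $A\notin\mathcal{I}$ with $A\setminus B_n\in\mathcal{I}$ for all $n$. *)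

theory Defs
  imports Complex_Main
begin

abbreviation posnat :: "nat set" where
  "posnat \<equiv> {1..}"

text \<open>Set functions are total on \<^typ>\<open>nat set\<close>; only their values on subsets of
  \<^term>\<open>posnat\<close> are constrained or used.\<close>

definition abstract_upper_density :: "(nat set \<Rightarrow> real) \<Rightarrow> bool" where
  "abstract_upper_density \<delta> \<longleftrightarrow>
     (\<forall>A. A \<subseteq> posnat \<longrightarrow> \<delta> A \<in> {0..1}) \<and>
     \<delta> posnat = 1 \<and>
     (\<forall>F. F \<subseteq> posnat \<longrightarrow> finite F \<longrightarrow> \<delta> F = 0) \<and>
     (\<forall>A B. A \<subseteq> B \<longrightarrow> B \<subseteq> posnat \<longrightarrow> \<delta> A \<le> \<delta> B) \<and>
     (\<forall>A B. A \<subseteq> posnat \<longrightarrow> B \<subseteq> posnat \<longrightarrow> \<delta> (A \<union> B) \<le> \<delta> A + \<delta> B)"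

definition atomless_density :: "(nat set \<Rightarrow> real) \<Rightarrow> bool" where
  "atomless_density \<delta> \<longleftrightarrow>
     (\<forall>A. A \<subseteq> posnat \<longrightarrow> \<delta> A > 0 \<longrightarrow> (\<exists>B. B \<subset> A \<and> 0 < \<delta> B \<and> \<delta> B < \<delta> A))"

definition zero_sets :: "(nat set \<Rightarrow> real) \<Rightarrow> nat set set" where
  "zero_sets \<delta> = {A. A \<subseteq> posnat \<and> \<delta> A = 0}"

definition set_ideal :: "nat set set \<Rightarrow> bool" where
  "set_ideal \<I> \<longleftrightarrow>
     \<I> \<subseteq> Pow posnat \<and> {} \<in> \<I> \<and>
     (\<forall>A B. A \<subseteq> B \<longrightarrow> B \<in> \<I> \<longrightarrow> A \<in> \<I>) \<and>
     (\<forall>A B. A \<in> \<I> \<longrightarrow> B \<in> \<I> \<longrightarrow> A \<union> B \<in> \<I>)"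

text \<open>Being an ideal is deliberately not a conjunct here, so that the negation of this property
  says something about the sequences; see \<open>set_ideal_zero_sets\<close> for the ideals of interest.\<close>

definition diagonal_intersection_property :: "nat set set \<Rightarrow> bool" where
  "diagonal_intersection_property \<I> \<longleftrightarrow>
     (\<forall>B :: nat \<Rightarrow> nat set.
        (\<forall>n\<in>posnat. B n \<subseteq> posnat \<and> B n \<notin> \<I> \<and> B (n + 1) - B n \<in> \<I>) \<longrightarrow>
        (\<exists>A. A \<subseteq> posnat \<and> A \<notin> \<I> \<and> (\<forall>n\<in>posnat. A - B n \<in> \<I>)))"

lemma set_ideal_zero_sets:
  assumes "abstract_upper_density \<delta>"
  shows "set_ideal (zero_sets \<delta>)"
proof -
  have nonneg: "0 \<le> \<delta> A" if "A \<subseteq> posnat" for A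
    using assms that unfolding abstract_upper_density_def by simp
  have mono: "\<delta> A \<le> \<delta> B" if "A \<subseteq> B" "B \<subseteq> posnat" for A B
    using assms that unfolding abstract_upper_density_def by blast
  have sub: "\<delta> (A \<union> B) \<le> \<delta> A + \<delta> B" if "A \<subseteq> posnat" "B \<subseteq> posnat" for A B
    using assms that unfolding abstract_upper_density_def by blast
  have empty: "\<delta> {} = 0"
    using assms unfolding abstract_upper_density_def by blast
  have down: "A \<in> zero_sets \<delta>" if "A \<subseteq> B" "B \<in> zero_sets \<delta>" for A B
  proof -
    have "A \<subseteq> posnat" "\<delta> A \<le> 0"
      using that mono[of A B] unfolding zero_sets_def by auto
    then show ?thesis
      using nonneg[of A] unfolding zero_sets_def by simp
  qed
  have un: "A \<union> B \<in> zero_sets \<delta>" if "A \<in> zero_sets \<delta>" "B \<in> zero_sets \<delta>" for A B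
  proof -
    have "A \<union> B \<subseteq> posnat" "\<delta> (A \<union> B) \<le> 0"
      using that sub[of A B] unfolding zero_sets_def by auto
    then show ?thesis
      using nonneg[of "A \<union> B"] unfolding zero_sets_def by simp
  qed
  have "zero_sets \<delta> \<subseteq> Pow posnat" "{} \<in> zero_sets \<delta>"
    using empty unfolding zero_sets_def by auto
  then show ?thesis
    using down un unfolding set_ideal_def by blast
qed

end

theory Submission imports Defs begin

text \<open>Choose a decreasing sequence of positive sets \<open>B n\<close> such that \<open>\<delta> (B (n + 1))\<close> exceeds the
  infimum of the positive values of \<open>\<delta>\<close> on subsets of \<open>B n\<close> by at most \<open>1 / (n + 1)\<close>.
  If \<open>A\<close> is positive and \<open>A - B n\<close> is null for all \<open>n\<close>, then any positive \<open>C \<subseteq> A\<close> satisfies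
  \<open>\<delta> A \<le> \<delta> (B (n + 1)) \<le> \<delta> (C \<inter> B n) + 1 / (n + 1) \<le> \<delta> C + 1 / (n + 1)\<close>,
  so \<open>\<delta> C = \<delta> A\<close> and \<open>A\<close> is an atom.\<close>

text \<open>The infimum of \<open>f\<close> over \<open>S\<close> need not be attained, but
  nonnegativity makes it finite, so some value of \<open>f\<close> lies within \<open>e\<close> of
  it.\<close>

lemma ex_almost_minimizer:
  fixes f :: "'a \<Rightarrow> real"
  assumes "x \<in> S" and "\<And>y. y \<in> S \<Longrightarrow> 0 \<le> f y" and "0 < e"
  shows "\<exists>y\<in>S. \<forall>z\<in>S. f y \<le> f z + e"
proof -
  have bdd: "bdd_below (f ` S)"
    using assms(2) by (intro bdd_belowI[of _ 0]) auto
  have "\<exists>v\<in>f ` S. v < Inf (f ` S) + e"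
    using assms(1,3) bdd by (subst cInf_less_iff[symmetric]) auto
  then obtain y where y: "y \<in> S" "f y < Inf (f ` S) + e"
    by blast
  have "f y \<le> f z + e" if "z \<in> S" for z
    using y(2) cInf_lower[OF imageI[OF that] bdd] by linarith
  with y(1) show ?thesis by blast
qed

text \<open>Subadditivity on the split of \<open>A\<close> along \<open>B\<close>. This allows a set
  to be cut down to a member of the chain without losing density.\<close>

lemma density_le_of_null_Diff:
  assumes "abstract_upper_density \<delta>"
    and "A - B \<in> zero_sets \<delta>" and "A \<subseteq> posnat"
  shows "\<delta> A \<le> \<delta> (A \<inter> B)"
proof -
  have "\<delta> ((A \<inter> B) \<union> (A - B)) \<le> \<delta> (A \<inter> B) + \<delta> (A - B)"
    using assms(1,3) unfolding abstract_upper_density_def by (meson Diff_subset inf_le1 order_trans)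
  moreover have "(A \<inter> B) \<union> (A - B) = A"
    by blast
  ultimately show ?thesis
    using assms(2) unfolding zero_sets_def by simp
qed

theorem theorem2p6:
  fixes \<delta> :: "nat set \<Rightarrow> real"
  assumes "abstract_upper_density \<delta>"
    and "atomless_density \<delta>"
  shows "\<not> diagonal_intersection_property (zero_sets \<delta>)"
proof
  assume dip: "diagonal_intersection_property (zero_sets \<delta>)"
  have nonneg: "0 \<le> \<delta> A" if "A \<subseteq> posnat" for A
    using assms(1) that unfolding abstract_upper_density_def by simp
  have mono: "\<delta> A \<le> \<delta> B" if "A \<subseteq> B" "B \<subseteq> posnat" for A B
    using assms(1) that unfolding abstract_upper_density_def by blast
  have total: "\<delta> posnat = 1" and empty: "\<delta> {} = 0"
    using assms(1) unfolding abstract_upper_density_def by blast+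
  define pos where "pos B = {C. C \<subseteq> B \<and> 0 < \<delta> C}" for B
  have "\<exists>B. \<forall>n. (B n \<subseteq> posnat \<and> 0 < \<delta> (B n)) \<and>
      (B (Suc n) \<subseteq> B n \<and> (\<forall>C\<in>pos (B n). \<delta> (B (Suc n)) \<le> \<delta> C + 1 / Suc n))"
  proof (rule dependent_nat_choice)
    show "\<exists>B. B \<subseteq> posnat \<and> 0 < \<delta> B"
      using total by (intro exI[of _ posnat]) simp
  next
    fix B n assume B: "B \<subseteq> posnat \<and> 0 < \<delta> B"
    \<comment> \<open>\<open>B\<close> itself lies in \<open>pos B\<close>, so the family to
      minimize over is nonempty.\<close>
    have "\<exists>D\<in>pos B. \<forall>C\<in>pos B. \<delta> D \<le> \<delta> C + 1 / Suc n"
      using B by (intro ex_almost_minimizer[of B]) (auto simp: pos_def)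
    then obtain D where "D \<in> pos B" "\<forall>C\<in>pos B. \<delta> D \<le> \<delta> C + 1 / Suc n"
      by blast
    with B show "\<exists>D. (D \<subseteq> posnat \<and> 0 < \<delta> D) \<and>
        (D \<subseteq> B \<and> (\<forall>C\<in>pos B. \<delta> D \<le> \<delta> C + 1 / Suc n))"
      unfolding pos_def by (intro exI[of _ D]) auto
  qed
  then obtain B where B: "\<And>n. B n \<subseteq> posnat" "\<And>n. 0 < \<delta> (B n)" "\<And>n. B (Suc n) \<subseteq> B n"
    and min: "\<And>n C. C \<in> pos (B n) \<Longrightarrow> \<delta> (B (Suc n)) \<le> \<delta> C + 1 / Suc n"
    by blast
  have B_chain: "B n \<subseteq> posnat \<and> B n \<notin> zero_sets \<delta> \<and> B (n + 1) - B n \<in> zero_sets \<delta>" for n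
  proof -
    have "B (n + 1) - B n = {}"
      using B(3)[of n] by simp
    then have "B (n + 1) - B n \<in> zero_sets \<delta>"
      using empty unfolding zero_sets_def by (simp only: mem_Collect_eq empty_subsetI)
    then show ?thesis
      using B(1,2)[of n] unfolding zero_sets_def by simp
  qed
  obtain A where A: "A \<subseteq> posnat" "A \<notin> zero_sets \<delta>"
    and null: "\<And>n. n \<in> posnat \<Longrightarrow> A - B n \<in> zero_sets \<delta>"
    using dip[unfolded diagonal_intersection_property_def, rule_format, of B, OF B_chain] by blast
  have "0 < \<delta> A"
    using A nonneg[of A] unfolding zero_sets_def by simp
  then obtain C where C: "C \<subset> A" "0 < \<delta> C" "\<delta> C < \<delta> A"
    using assms(2) A(1) unfolding atomless_density_def by blast
  \<comment> \<open>\<open>null\<close> says nothing at index 0, so the Archimedean index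
    \<open>m\<close> is shifted to \<open>Suc m\<close>, which only shrinks the bound.\<close>
  obtain n where n: "1 / Suc n < \<delta> A - \<delta> C" "n \<noteq> 0"
  proof -
    obtain m where m: "inverse (real (Suc m)) < \<delta> A - \<delta> C"
      using C(3) reals_Archimedean[of "\<delta> A - \<delta> C"] by auto
    have "1 / real (Suc (Suc m)) \<le> inverse (real (Suc m))"
      by (simp add: field_simps)
    with m that[of "Suc m"] show thesis by simp
  qed
  \<comment> \<open>\<open>C \<inter> B n\<close> must be positive to compete with
    \<open>B (Suc n)\<close>; since \<open>C - B n\<close> is null, it keeps the full density of
    \<open>C\<close>.\<close>
  have "A - B n \<in> zero_sets \<delta>"
    using n(2) by (intro null) simp
  moreover have "C - B n \<subseteq> A - B n"
    using C(1) by blast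
  ultimately have "C - B n \<in> zero_sets \<delta>"
    using set_ideal_zero_sets[OF assms(1)] unfolding set_ideal_def by blast
  then have "\<delta> C \<le> \<delta> (C \<inter> B n)"
    using C(1) A(1) by (intro density_le_of_null_Diff[OF assms(1)]) auto
  then have "C \<inter> B n \<in> pos (B n)"
    using C(2) unfolding pos_def by simp
  have "\<delta> A \<le> \<delta> (A \<inter> B (Suc n))"
    using A(1) by (intro density_le_of_null_Diff[OF assms(1)] null) auto
  also have "\<dots> \<le> \<delta> (B (Suc n))"
    using B(1) by (intro mono) auto
  also have "\<dots> \<le> \<delta> (C \<inter> B n) + 1 / Suc n"
    using \<open>C \<inter> B n \<in> pos (B n)\<close> by (rule min)
  also have "\<dots> \<le> \<delta> C + 1 / Suc n"
    using C(1) A(1) mono[of "C \<inter> B n" C] by auto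
  finally show False
    using n(1) by linarith
qed

end
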